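(* Assume $\mathfrak b=\mathfrak s=\mathfrak c$. Then nowhere MAD fin-intersecting almost disjoint families exist generically; that is, every almost disjoint family on $\omega$ of cardinality less than $\mathfrak c$ can be extended to (is contained in) an almost disjoint family on $\omega$ that is both fin-intersecting and nowhere MAD.
   Context: An almost disjoint family on $\omega$ is an infinite set $\mathcal A$ of infinite subsets of $\omega$ such that $a\cap b$ is finite for all distinct $a,b\in\mathcal A$. $\mathcal I(\mathcal A)=\{X\subseteq\omega: \exists \mathcal B\in[\mathcal A]^{<\omega}\ X\subseteq^*\bigcup\mathcal B\}$, where $X\subseteq^*Y$ means $X\setminus Y$ is finite, and $\mathcal I^+(\mathcal A)=\mathcal P(\omega)\setminus\mathcal I(\mathcal A)$. $\mathcal A$ is nowhere MAD if for every $X\in\mathcal I^+(\mathcal A)$ there is an infinite $b\subseteq X$ such that $b\cap a$ is finite for all $a\in\mathcal A$. A fin sequence is a function $C:\omega\to[\omega]^{<\omega}\setminus\{\emptyset\}$ with $C(n)\cap C(m)=\emptyset$ whenever $n\neq m$. A collection of sets is centered if every finite nonempty subcollection has infinite intersection. An almost disjoint family $\mathcal A$ is fin-intersecting if for every fin sequence $C$ there exists an infinite $I\subseteq\omega$ such that $\{\{n\in I: a\cap C(n)\neq\emptyset\}: a\in\mathcal A\}\setminus[I]^{<\omega}$ is centered, where $[I]^{<\omega}$ is the set of finite subsets of $I$. $\mathfrak c=2^{\aleph_0}$. $\mathfrak b$ is the least cardinality of a family $\mathcal B\subseteq\omega^\omega$ such that for every $g\in\omega^\omega$ there is $f\in\mathcal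 B$ with $f\not\leq^* g$, where $f\leq^* g$ means $\{n: g(n)<f(n)\}$ is finite. $\mathfrak s$ is the least cardinality of a collection $\mathcal S$ of infinite subsets of $\omega$ such that for every infinite $X\subseteq\omega$ there is $S\in\mathcal S$ with both $X\cap S$ and $X\setminus S$ infinite. *)

theory Defs
  imports Main "HOL-Library.Disjoint_Sets" "HOL-Library.Infinite_Set"
begin

unbundle cardinal_syntax

text \<open>
  The least cardinality of a set satisfying \<open>P\<close>, as a cardinal order (hence only meaningful up
  to \<open>=o\<close>). The choice is well defined as soon as some set satisfies \<open>P\<close>; see
  \<open>least_cardinality\<close> below.
\<close>

definition least_cardinality :: "('a set \<Rightarrow> bool) \<Rightarrow> 'a rel" where
  "least_cardinality P = |SOME A. P A \<and> (\<forall>B. P B \<longrightarrow> |A| \<le>o |B| )|"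

lemma least_cardinality:
  assumes "P B"
  shows "\<exists>A. P A \<and> least_cardinality P = |A|"
    and "least_cardinality P \<le>o |B|"
proof -
  let ?Q = "\<lambda>A. P A \<and> (\<forall>B. P B \<longrightarrow> |A| \<le>o |B| )"
  have "\<exists>r \<in> card_of ` {A. P A}. \<forall>r' \<in> card_of ` {A. P A}. r \<le>o r'"
    by (rule exists_minim_Card_order) (use assms card_of_Card_order in auto)
  then have "\<exists>A. ?Q A" by auto
  then have "?Q (SOME A. ?Q A)" by (rule someI_ex)
  with assms show "\<exists>A. P A \<and> least_cardinality P = |A|" "least_cardinality P \<le>o |B|"
    unfolding least_cardinality_def by blast+
qed

definition eventually_le :: "(nat \<Rightarrow> nat) \<Rightarrow> (nat \<Rightarrow> nat) \<Rightarrow> bool"  (infix "\<le>\<^sup>*" 50) where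
  "f \<le>\<^sup>* g \<longleftrightarrow> finite {n. g n < f n}"

definition unbounded_family :: "(nat \<Rightarrow> nat) set \<Rightarrow> bool" where
  "unbounded_family \<B> \<longleftrightarrow> (\<forall>g. \<exists>f \<in> \<B>. \<not> f \<le>\<^sup>* g)"

definition splitting_family :: "nat set set \<Rightarrow> bool" where
  "splitting_family \<S> \<longleftrightarrow>
     (\<forall>S \<in> \<S>. infinite S) \<and>
     (\<forall>X. infinite X \<longrightarrow> (\<exists>S \<in> \<S>. infinite (X \<inter> S) \<and> infinite (X - S)))"

definition bounding_number :: "(nat \<Rightarrow> nat) rel"  ("\<bb>") where
  "\<bb> = least_cardinality unbounded_family"

definition splitting_number :: "nat set rel"  ("\<ss>") where
  "\<ss> = least_cardinality splitting_family"

definition continuum :: "nat set rel"  ("\<cc>") where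
  "\<cc> = |UNIV :: nat set set|"

lemma unbounded_family_UNIV: "unbounded_family UNIV"
proof -
  have "\<not> (\<lambda>n. Suc (g n)) \<le>\<^sup>* g" for g
    by (simp add: eventually_le_def)
  then show ?thesis unfolding unbounded_family_def by blast
qed

lemma splitting_family_infinite_sets: "splitting_family {S. infinite S}"
proof -
  have "\<exists>S. infinite S \<and> infinite (X \<inter> S) \<and> infinite (X - S)" if "infinite X" for X :: "nat set"
  proof -
    let ?e = "enumerate X"
    have inj: "inj ?e" and ran: "range ?e = X"
      using that bij_enumerate[of X] by (auto simp: bij_betw_def)
    let ?S = "?e ` {n. even n}" and ?T = "?e ` {n. odd n}"
    have "infinite {n::nat. even n}" "infinite {n::nat. odd n}"
      unfolding infinite_nat_iff_unbounded
      by (metis (mono_tags) even_Suc lessI less_SucI mem_Collect_eq)+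
    then have "infinite ?S" "infinite ?T"
      using inj by (metis finite_imageD inj_on_subset subset_UNIV)+
    moreover have "X \<inter> ?S = ?S" using ran by auto
    moreover have "?T \<subseteq> X - ?S"
      using ran inj by (auto dest: injD)
    ultimately show ?thesis by (metis finite_subset)
  qed
  then show ?thesis unfolding splitting_family_def by blast
qed

definition almost_disjoint_family :: "nat set set \<Rightarrow> bool" where
  "almost_disjoint_family \<A> \<longleftrightarrow>
     infinite \<A> \<and> (\<forall>a \<in> \<A>. infinite a) \<and>
     (\<forall>a \<in> \<A>. \<forall>b \<in> \<A>. a \<noteq> b \<longrightarrow> finite (a \<inter> b))"

definition ad_ideal :: "nat set set \<Rightarrow> nat set set"  ("\<I>") where
  "\<I> \<A> = {X. \<exists>\<B>. finite \<B> \<and> \<B> \<subseteq> \<A> \<and> finite (X - \<Union>\<B>)}"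

definition ad_positive :: "nat set set \<Rightarrow> nat set set"  ("\<I>\<^sup>+") where
  "\<I>\<^sup>+ \<A> = UNIV - \<I> \<A>"

definition nowhere_MAD :: "nat set set \<Rightarrow> bool" where
  "nowhere_MAD \<A> \<longleftrightarrow>
     (\<forall>X \<in> \<I>\<^sup>+ \<A>. \<exists>b. infinite b \<and> b \<subseteq> X \<and> (\<forall>a \<in> \<A>. finite (b \<inter> a)))"

definition fin_sequence :: "(nat \<Rightarrow> nat set) \<Rightarrow> bool" where
  "fin_sequence C \<longleftrightarrow> (\<forall>n. finite (C n) \<and> C n \<noteq> {}) \<and> disjoint_family C"

definition centered :: "'a set set \<Rightarrow> bool" where
  "centered \<F> \<longleftrightarrow> (\<forall>\<G>. finite \<G> \<and> \<G> \<noteq> {} \<and> \<G> \<subseteq> \<F> \<longrightarrow> infinite (\<Inter>\<G>))"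

definition fin_intersecting :: "nat set set \<Rightarrow> bool" where
  "fin_intersecting \<A> \<longleftrightarrow>
     (\<forall>C. fin_sequence C \<longrightarrow>
        (\<exists>I. infinite I \<and> centered ((\<lambda>a. {n \<in> I. a \<inter> C n \<noteq> {}}) ` \<A> - Fpow I)))"

end

theory Submission
  imports Defs
begin

text \<open>
  An almost disjoint family of cardinality below both \<open>\<bb>\<close> and \<open>\<ss>\<close> is already nowhere MAD and
  fin-intersecting, so under \<open>\<bb> = \<ss> = \<cc>\<close> every family of cardinality less than \<open>\<cc>\<close> serves as
  its own extension.

  Below \<open>\<ss>\<close>: given a fin sequence \<open>C\<close>, the index sets \<open>{n. a \<inter> C n \<noteq> {}}\<close>, one for each member
  \<open>a\<close>, are too few to split every infinite set. On an infinite set \<open>I\<close> that none of them splits,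
  each trace is finite or cofinite in \<open>I\<close>, and the cofinite subsets of \<open>I\<close> are centered.

  Below \<open>\<bb>\<close>: let \<open>X\<close> be positive. If only finitely many members meet \<open>X\<close> in an infinite set,
  it suffices to delete them from \<open>X\<close>. Otherwise \<open>X\<close> meets infinitely many distinct members
  \<open>a\<^sub>0, a\<^sub>1, \<dots>\<close> in infinite sets, and the required set picks one point \<open>x\<^sub>n\<close> from each
  \<open>X \<inter> a\<^sub>n\<close>, outside the earlier \<open>a\<^sub>m\<close>. Every other member \<open>a\<close> has finite intersection with
  each \<open>a\<^sub>n\<close>, so it gives a function bounding \<open>a \<inter> a\<^sub>n\<close>; as there are fewer than \<open>\<bb>\<close> such
  functions, one \<open>g\<close> dominates them all, and \<open>x\<^sub>n \<ge> g n\<close> keeps \<open>x\<^sub>n\<close> out of \<open>a\<close> for almost all \<open>n\<close>.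
\<close>

lemma not_splitting_if_less_splitting_number:
  assumes "|\<S>| <o \<ss>"
  shows "\<not> splitting_family \<S>"
  using assms least_cardinality(2)[of splitting_family \<S>] not_ordLess_ordLeq
  unfolding splitting_number_def by blast

lemma dominated_if_less_bounding_number:
  assumes "|\<B>| <o \<bb>"
  obtains g where "\<And>f. f \<in> \<B> \<Longrightarrow> f \<le>\<^sup>* g"
proof -
  have "\<not> unbounded_family \<B>"
    using assms least_cardinality(2)[of unbounded_family \<B>] not_ordLess_ordLeq
    unfolding bounding_number_def by blast
  then show thesis using that unfolding unbounded_family_def by blast
qed

lemma centered_cofinite_subsets:
  assumes "infinite I" and "\<And>S. S \<in> \<F> \<Longrightarrow> finite (I - S)"
  shows "centered \<F>"
  unfolding centered_def
proof (intro allI impI)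
  fix \<G> assume \<G>: "finite \<G> \<and> \<G> \<noteq> {} \<and> \<G> \<subseteq> \<F>"
  then have "finite (\<Union>S\<in>\<G>. I - S)" using assms(2) by blast
  moreover have "I \<subseteq> \<Inter>\<G> \<union> (\<Union>S\<in>\<G>. I - S)" by blast
  ultimately show "infinite (\<Inter>\<G>)"
    using assms(1) finite_subset by blast
qed

text \<open>
  Splitting families consist of infinite sets, so finite index sets are left out of the family to
  which the definition of \<open>\<ss>\<close> is applied; they split nothing anyway.
\<close>

lemma fin_intersecting_if_less_splitting_number:
  assumes "|\<A>| <o \<ss>"
  shows "fin_intersecting \<A>"
  unfolding fin_intersecting_def
proof (intro allI impI)
  fix C :: "nat \<Rightarrow> nat set"
  define hits where "hits a = {n. a \<inter> C n \<noteq> {}}" for a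
  define \<S> where "\<S> = {S \<in> hits ` \<A>. infinite S}"
  have "|\<S>| \<le>o |hits ` \<A>|" by (rule card_of_mono1) (auto simp: \<S>_def)
  then have "|\<S>| <o \<ss>"
    using card_of_image assms ordLeq_transitive ordLeq_ordLess_trans by blast
  then obtain I where I: "infinite I"
    and unsplit: "\<And>S. S \<in> \<S> \<Longrightarrow> finite (I \<inter> S) \<or> finite (I - S)"
    using not_splitting_if_less_splitting_number[of \<S>]
    unfolding splitting_family_def \<S>_def by blast
  have "centered ((\<lambda>a. {n \<in> I. a \<inter> C n \<noteq> {}}) ` \<A> - Fpow I)"
  proof (rule centered_cofinite_subsets[OF I])
    fix T assume "T \<in> (\<lambda>a. {n \<in> I. a \<inter> C n \<noteq> {}}) ` \<A> - Fpow I"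
    then obtain a where a: "a \<in> \<A>" and T: "T = I \<inter> hits a" and inf: "infinite (I \<inter> hits a)"
      by (auto simp: hits_def Fpow_def Int_def)
    then have "hits a \<in> \<S>" by (auto simp: \<S>_def)
    then have "finite (I - hits a)" using unsplit inf by blast
    then show "finite (I - T)" by (simp add: T Diff_Int)
  qed
  with I show "\<exists>I. infinite I \<and> centered ((\<lambda>a. {n \<in> I. a \<inter> C n \<noteq> {}}) ` \<A> - Fpow I)"
    by blast
qed

text \<open>
  The diagonal argument: the bound \<open>g\<close> takes care of the members outside the sequence \<open>e\<close>, and
  avoiding \<open>e m\<close> from index \<open>m + 1\<close> on takes care of the members of the sequence.
\<close>

lemma almost_disjoint_transversal:
  fixes e :: "nat \<Rightarrow> nat set"
  assumes ad: "almost_disjoint_family \<A>" and card: "|\<A>| <o \<bb>"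
    and inj: "inj e" and e: "\<And>n. e n \<in> \<A>" "\<And>n. infinite (X \<inter> e n)"
  shows "\<exists>b. infinite b \<and> b \<subseteq> X \<and> (\<forall>a \<in> \<A>. finite (b \<inter> a))"
proof -
  have fin: "finite (a \<inter> e n)" if "a \<in> \<A>" "a \<noteq> e n" for a n
    using ad that e(1) unfolding almost_disjoint_family_def by blast
  have "|(\<lambda>a n. Suc (Max (a \<inter> e n))) ` \<A>| <o \<bb>"
    using card_of_image card by (rule ordLeq_ordLess_trans)
  then obtain g where g: "\<And>a. a \<in> \<A> \<Longrightarrow> (\<lambda>n. Suc (Max (a \<inter> e n))) \<le>\<^sup>* g"
    by (rule dominated_if_less_bounding_number) blast
  have "\<exists>x \<in> X \<inter> e n. x \<notin> (\<Union>m<n. e m) \<and> g n \<le> x" for n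
  proof -
    have "finite (e m \<inter> e n)" if "m < n" for m
      using that inj by (intro fin e(1)) (auto dest: injD)
    then have "finite (\<Union>m<n. e m \<inter> e n)" by blast
    then have "infinite (X \<inter> e n - ((\<Union>m<n. e m \<inter> e n) \<union> {..<g n}))"
      by (intro Diff_infinite_finite e(2)) simp
    then obtain x where "x \<in> X \<inter> e n - ((\<Union>m<n. e m \<inter> e n) \<union> {..<g n})"
      using infinite_imp_nonempty by blast
    then show ?thesis by (intro bexI[of _ x]) auto
  qed
  then obtain x where x: "\<And>n. x n \<in> X" "\<And>n. x n \<in> e n"
    "\<And>m n. m < n \<Longrightarrow> x n \<notin> e m" "\<And>n. g n \<le> x n"
    by (metis IntE UN_I lessThan_iff)
  have "inj x"
    using x(2,3) by (metis injI linorder_neqE_nat)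
  then have "infinite (range x)" by (rule range_inj_infinite)
  moreover have "finite (range x \<inter> a)" if a: "a \<in> \<A>" for a
  proof -
    have "finite {n. x n \<in> a}"
    proof (cases "a \<in> range e")
      case True
      then obtain m where "a = e m" by blast
      then have "{n. x n \<in> a} \<subseteq> {..m}" using x(3) by (auto simp: not_less[symmetric])
      then show ?thesis by (rule finite_subset) simp
    next
      case False
      have "{n. x n \<in> a} \<subseteq> {n. g n < Suc (Max (a \<inter> e n))}"
      proof clarify
        fix n assume "x n \<in> a"
        moreover have "finite (a \<inter> e n)" using fin[OF a] False by blast
        ultimately have "x n \<le> Max (a \<inter> e n)" using x(2) by simp
        then show "g n < Suc (Max (a \<inter> e n))" using x(4)[of n] by linarith
      qed
      then show ?thesis using g[OF a] finite_subset unfolding eventually_le_def by blast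
    qed
    moreover have "range x \<inter> a = x ` {n. x n \<in> a}" by blast
    ultimately show ?thesis by simp
  qed
  ultimately show ?thesis using x(1) by (intro exI[of _ "range x"]) auto
qed

lemma nowhere_MAD_if_less_bounding_number:
  assumes ad: "almost_disjoint_family \<A>" and card: "|\<A>| <o \<bb>"
  shows "nowhere_MAD \<A>"
  unfolding nowhere_MAD_def
proof
  fix X assume X: "X \<in> \<I>\<^sup>+ \<A>"
  define \<F> where "\<F> = {a \<in> \<A>. infinite (X \<inter> a)}"
  show "\<exists>b. infinite b \<and> b \<subseteq> X \<and> (\<forall>a \<in> \<A>. finite (b \<inter> a))"
  proof (cases "finite \<F>")
    case True
    then have "infinite (X - \<Union>\<F>)"
      using X unfolding ad_positive_def ad_ideal_def \<F>_def by blast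
    moreover have "finite ((X - \<Union>\<F>) \<inter> a)" if "a \<in> \<A>" for a
    proof (cases "a \<in> \<F>")
      case True
      then have "(X - \<Union>\<F>) \<inter> a = {}" by blast
      then show ?thesis by simp
    next
      case False
      then have "finite (X \<inter> a)" using that by (simp add: \<F>_def)
      then show ?thesis by (rule rev_finite_subset) blast
    qed
    ultimately show ?thesis by blast
  next
    case False
    then obtain e :: "nat \<Rightarrow> nat set" where "inj e" "range e \<subseteq> \<F>"
      using infinite_countable_subset by blast
    then show ?thesis
      by (intro almost_disjoint_transversal[OF ad card, of e]) (auto simp: \<F>_def)
  qed
qed

theorem theorem16:
  assumes "\<bb> =o \<cc>" and "\<ss> =o \<cc>"
  shows "\<forall>\<A>. almost_disjoint_family \<A> \<and> |\<A>| <o \<cc> \<longrightarrow>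
           (\<exists>\<A>'. \<A> \<subseteq> \<A>' \<and> almost_disjoint_family \<A>' \<and>
                 fin_intersecting \<A>' \<and> nowhere_MAD \<A>')"
proof (intro allI impI, elim conjE)
  fix \<A> assume ad: "almost_disjoint_family \<A>" and less: "|\<A>| <o \<cc>"
  have "|\<A>| <o \<bb>" "|\<A>| <o \<ss>"
    using less assms ordIso_symmetric ordLess_ordIso_trans by blast+
  then have "fin_intersecting \<A>" "nowhere_MAD \<A>"
    using ad fin_intersecting_if_less_splitting_number nowhere_MAD_if_less_bounding_number by auto
  with ad show "\<exists>\<A>'. \<A> \<subseteq> \<A>' \<and> almost_disjoint_family \<A>' \<and>
                 fin_intersecting \<A>' \<and> nowhere_MAD \<A>'"
    by blast
qed

end
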